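(* For $\lambda\in(-\lambda_0,\lambda_0)$ let $y_1^\lambda(t_1),\dots,y_{d-l}^\lambda(t_1,\dots,t_{d-l})$ be the solution, on $I_1\times\dots\times I_{d-l}$, of the perturbed iterated differential system described in the context, and let $z_j^\lambda(t_1,\dots,t_j)=\frac{\partial}{\partial\lambda}y_j^\lambda(t_1,\dots,t_j)\in\mathbb{R}^d$, $j=1,\dots,d-l$. Then: a) the last $d-l$ components of $z_1^\lambda(t_1),\dots,z_{d-l}^\lambda(t_1,\dots,t_{d-l})$ are null; b) for any $j=1,\dots,d-l$ and $(t_1,\dots,t_{d-l})\in I_1\times\dots\times I_{d-l}$, $z_j^\lambda=z_j^\lambda(t_1,\dots,t_j)$ is the unique solution (among vectors of $\mathbb{R}^d$ whose last $d-l$ components are null) of $$\nabla_yF_k^\lambda(y_j^\lambda)\cdot z_j^\lambda+\partial_\lambda F_k^\lambda(y_j^\lambda)=0,\qquad k=1,\dots,l,$$ where $y_j^\lambda=y_j^\lambda(t_1,\dots,t_j)$.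
   Context: Setting: $1\le l\le d-1$ are integers, $\Omega\subset\mathbb{R}^d$ is a bounded domain, $x^0\in\Omega$. The functions $(x,\lambda)\mapsto F_k^\lambda(x)$, $k=1,\dots,l$, are real valued and of class $C^2(\Omega\times(-1,1))$, with $F_k^\lambda(x^0)=0$ for all $k$ and all $\lambda\in(-1,1)$; put $F_k=F_k^0$. It is assumed that the Jacobian determinant $\det\left(\frac{\partial F_i}{\partial x_j}(x^0)\right)_{1\le i,j\le l}$ is nonzero. Consequently there are $\lambda_0>0$ small and a neighbourhood $V_1$ of $x^0$, $V_1\subset\Omega$, independent of $\lambda$, such that $\det\left(\frac{\partial F_i^\lambda}{\partial x_j}(x)\right)_{1\le i,j\le l}\ne 0$ for $x\in V_1$, $|\lambda|<\lambda_0$. For $s=1,\dots,d-l$, $x\in V_1$, $|\lambda|<\lambda_0$, $v_s^\lambda(x)\in\mathbb{R}^d$ is the unique vector with $v_s^\lambda(x)\cdot\nabla F_k^\lambda(x)=0$, $k=1,\dots,l$, whose last $d-l$ components are the $s$-th row of the identity matrix of $\mathbb{R}^{d-l}$. The perturbed iterated system is: $\frac{\partial y_1^\lambda}{\partial t_1}=v_1^\lambda(y_1^\lambda)$, $y_1^\lambda(0)=x^0$; and, for $j=2,\dots,d-l$, $\frac{\partial y_j^\lambda}{\partial t_j}(t_1,\dots,t_j)=v_j^\lambda(y_j^\lambda(t_1,\dots,t_j))$, $y_j^\lambda(t_1,\dots,t_{j-1},0)=y_{j-1}^\lambda(t_1,\dots,t_{j-1})$. The closed intervals $I_1,\dots,I_{d-l}$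 contain $0$ in their interior, are independent of $\lambda\in(-\lambda_0,\lambda_0)$, and are such that for these $\lambda$ the solution $y_j^\lambda$ is defined on $I_1\times\dots\times I_j$ with values in $V_1$; $y_j^\lambda$ is differentiable with respect to $\lambda$. *)

theory Defs
  imports "Jordan_Normal_Form.Determinant" "HOL-Analysis.Analysis"
begin

no_notation Matrix.vec_index (infixl \<open>$\<close> 100)
no_notation Matrix.scalar_prod (infix \<open>\<bullet>\<close> 70)

text \<open>
  The coordinates of \<^typ>\<open>real ^ 'd\<close> are indexed by an unordered finite type. An enumeration
  \<open>e\<close> of the index type by \<open>{1..CARD('d)}\<close> gives the coordinates \<open>x\<^sub>i\<close>, written \<open>x $ e i\<close>.
\<close>

text \<open>Intended for open \<open>S\<close>: the derivatives are taken in the full space.\<close>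

definition C2_on :: "('a::real_normed_vector \<Rightarrow> 'b::real_normed_vector) \<Rightarrow> 'a set \<Rightarrow> bool" where
  "C2_on f S \<longleftrightarrow>
     (\<exists>(f' :: 'a \<Rightarrow> 'a \<Rightarrow>\<^sub>L 'b) (f'' :: 'a \<Rightarrow> 'a \<Rightarrow>\<^sub>L 'a \<Rightarrow>\<^sub>L 'b).
        (\<forall>x\<in>S. (f has_derivative blinfun_apply (f' x)) (at x)) \<and>
        (\<forall>x\<in>S. (f' has_derivative blinfun_apply (f'' x)) (at x)) \<and>
        continuous_on S f'')"

definition partial_deriv :: "'d \<Rightarrow> (real ^ 'd \<Rightarrow> real) \<Rightarrow> real ^ 'd \<Rightarrow> real" where
  "partial_deriv i f x = deriv (\<lambda>h. f (x + h *\<^sub>R axis i 1)) 0"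

definition gradient :: "(real ^ 'd \<Rightarrow> real) \<Rightarrow> real ^ 'd \<Rightarrow> real ^ 'd" where
  "gradient f x = (\<chi> i. partial_deriv i f x)"

text \<open>Matrices in \<open>Matrix.mat\<close> are indexed from 0, hence the successors.\<close>

definition jacobian_det ::
  "(nat \<Rightarrow> 'd) \<Rightarrow> nat \<Rightarrow> (nat \<Rightarrow> real ^ 'd \<Rightarrow> real) \<Rightarrow> real ^ 'd \<Rightarrow> real" where
  "jacobian_det e l f x =
     Determinant.det (Matrix.mat l l (\<lambda>(i, j). partial_deriv (e (Suc j)) (f (Suc i)) x))"

text \<open>The vector is meaningful where \<open>jacobian_det e l f x \<noteq> 0\<close>, so that it is unique.\<close>

definition tangent_vec ::
  "(nat \<Rightarrow> 'd::finite) \<Rightarrow> nat \<Rightarrow> (nat \<Rightarrow> real ^ 'd \<Rightarrow> real) \<Rightarrow> nat \<Rightarrow> real ^ 'd \<Rightarrow> real ^ 'd" where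
  "tangent_vec e l f s x =
     (THE v. (\<forall>k\<in>{1..l}. v \<bullet> gradient (f k) x = 0) \<and>
             (\<forall>r\<in>{1..CARD('d) - l}. v $ e (l + r) = (if r = s then 1 else 0)))"

text \<open>
  A family \<open>y\<close> solves the iterated system on \<open>I 1 \<times> \<dots> \<times> I (d - l)\<close>, with values in \<open>V\<close>. Here
  \<open>y j t\<close> takes a tuple \<open>t = (t 1, \<dots>, t j)\<close>, an extensional function on \<open>{1..j}\<close>; thus
  \<open>t(j := \<tau>)\<close> extends a tuple of length \<open>j - 1\<close> by \<open>\<tau>\<close>, and for \<open>j = 1\<close> the shorter tuple is
  empty. At an endpoint of \<open>I j\<close> the derivative is one-sided.
\<close>

definition iterated_solution ::
  "(nat \<Rightarrow> 'd::finite) \<Rightarrow> nat \<Rightarrow> (nat \<Rightarrow> real ^ 'd \<Rightarrow> real) \<Rightarrow> real ^ 'd \<Rightarrow> (real ^ 'd) set \<Rightarrow>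
   (nat \<Rightarrow> real set) \<Rightarrow> (nat \<Rightarrow> (nat \<Rightarrow> real) \<Rightarrow> real ^ 'd) \<Rightarrow> bool" where
  "iterated_solution e l f x0 V I y \<longleftrightarrow>
     (\<forall>j\<in>{1..CARD('d) - l}.
        (\<forall>t \<in> (\<Pi>\<^sub>E i\<in>{1..j}. I i). y j t \<in> V) \<and>
        (\<forall>t \<in> (\<Pi>\<^sub>E i\<in>{1..j - 1}. I i).
           y j (t(j := 0)) = (if j = 1 then x0 else y (j - 1) t) \<and>
           (\<forall>\<tau>\<in>I j.
              ((\<lambda>\<tau>. y j (t(j := \<tau>))) has_vector_derivative
                 tangent_vec e l f j (y j (t(j := \<tau>)))) (at \<tau> within I j))))"

end

theory Submission
  imports Defs
begin

text \<open>
  Along the iterated flow the functions \<open>F\<^sub>k\<close> are constant, since the fields are orthogonal to their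
  gradients, and the last \<open>d - l\<close> coordinates grow linearly with slopes 0 or 1 that do not depend on
  \<open>\<lambda>\<close>. Differentiating these two identities in \<open>\<lambda>\<close> gives the linear system for \<open>z\<^sub>j\<close>, whose solution
  is unique because the Jacobian determinant does not vanish.
\<close>

section \<open>Gradients and the linear system attached to the Jacobian\<close>

lemma gradient_inner:
  assumes "(f has_derivative f') (at x)"
  shows "gradient f x \<bullet> w = f' w"
proof -
  interpret bounded_linear f'
    using assms by (rule has_derivative_bounded_linear)
  \<comment> \<open>The chain rule along the \<open>i\<close>-th coordinate line turns the
    one-variable \<open>deriv\<close> into a value of the Frechet derivative.\<close>
  have "partial_deriv i f x = f' (axis i 1)" for i
  proof -
    have "((\<lambda>h. x + h *\<^sub>R axis i 1) has_derivative (\<lambda>h. h *\<^sub>R axis i 1)) (at 0)"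
      by (auto intro!: derivative_eq_intros)
    then have "((\<lambda>h. f (x + h *\<^sub>R axis i 1)) has_derivative (\<lambda>h. f' (h *\<^sub>R axis i 1))) (at (0::real))"
      by (rule has_derivative_compose) (use assms in simp)
    then have "((\<lambda>h. f (x + h *\<^sub>R axis i 1)) has_real_derivative f' (axis i 1)) (at 0)"
      unfolding has_field_derivative_def by (simp add: scaleR mult.commute[of _ "f' _"] mult_commute_abs)
    then show ?thesis
      unfolding partial_deriv_def by (rule DERIV_imp_deriv)
  qed
  then have "gradient f x \<bullet> w = (\<Sum>i\<in>UNIV. f' (w $ i *\<^sub>R axis i 1))"
    by (simp add: gradient_def inner_vec_def scaleR mult.commute)
  also have "\<dots> = f' (\<Sum>i\<in>UNIV. w $ i *\<^sub>R axis i 1)"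
    by (simp add: sum)
  also have "(\<Sum>i\<in>UNIV. w $ i *\<^sub>R axis i 1) = w"
    using basis_expansion[of w] by (simp add: scalar_mult_eq_scaleR)
  finally show ?thesis .
qed

text \<open>Once the last coordinates vanish, the orthogonality relations involve only the first
  \<open>l\<close> coordinates and form a square homogeneous system whose determinant is
  \<open>jacobian_det\<close>. This is the source of every uniqueness claim below.\<close>

lemma jacobian_system_trivial_kernel:
  fixes e :: "nat \<Rightarrow> 'd::finite"
  assumes e: "bij_betw e {1..CARD('d)} UNIV"
    and l: "l \<le> CARD('d)"
    and det: "jacobian_det e l f x \<noteq> 0"
    and orth: "\<And>k. k \<in> {1..l} \<Longrightarrow> v \<bullet> gradient (f k) x = 0"
    and null: "\<And>r. r \<in> {1..CARD('d) - l} \<Longrightarrow> v $ e (l + r) = 0"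
  shows "v = 0"
proof -
  define A where "A = Matrix.mat l l (\<lambda>(i, j). partial_deriv (e (Suc j)) (f (Suc i)) x)"
  define u where "u = Matrix.vec l (\<lambda>j. v $ e (Suc j))"
  have A: "A \<in> carrier_mat l l" and u: "u \<in> carrier_vec l"
    by (simp_all add: A_def u_def)
  have tail: "v $ e m = 0" if "m \<in> {Suc l..CARD('d)}" for m
  proof -
    have "m - l \<in> {1..CARD('d) - l}"
      using that by (auto simp: diff_le_mono)
    from null[OF this] show ?thesis
      using that by simp
  qed
  have "A *\<^sub>v u = 0\<^sub>v l"
  proof (rule eq_vecI)
    fix i assume "i < dim_vec (0\<^sub>v l :: real Matrix.vec)"
    then have i: "i < l" by simp
    \<comment> \<open>Row \<open>i\<close> of the product is the orthogonality relation number
      \<open>Suc i\<close>: enumerate the coordinates by \<open>e\<close>, drop those beyond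
      \<open>l\<close>, and shift the summation index to start at 0.\<close>
    have "0 = v \<bullet> gradient (f (Suc i)) x"
      using orth[of "Suc i"] i by simp
    also have "\<dots> = (\<Sum>a\<in>UNIV. partial_deriv a (f (Suc i)) x * v $ a)"
      by (simp add: gradient_def inner_vec_def mult.commute)
    also have "\<dots> = (\<Sum>m\<in>{1..CARD('d)}. partial_deriv (e m) (f (Suc i)) x * v $ e m)"
      by (rule sum.reindex_bij_betw[OF e, symmetric])
    also have "\<dots> = (\<Sum>m\<in>{1..l}. partial_deriv (e m) (f (Suc i)) x * v $ e m)"
      using l tail by (intro sum.mono_neutral_right) auto
    also have "\<dots> = (\<Sum>m\<in>{0..<l}. partial_deriv (e (Suc m)) (f (Suc i)) x * v $ e (Suc m))"
      by (simp only: One_nat_def sum.atLeast1_atMost_eq atLeast0LessThan)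
    also have "\<dots> = Matrix.vec_index (A *\<^sub>v u) i"
      using i by (simp add: A_def u_def Matrix.scalar_prod_def)
    finally show "Matrix.vec_index (A *\<^sub>v u) i = Matrix.vec_index (0\<^sub>v l) i"
      using i by simp
  qed (use A in auto)
  moreover have "Determinant.det A \<noteq> 0"
    using det by (simp add: jacobian_det_def A_def)
  ultimately have "u = 0\<^sub>v l"
    using det_0_iff_vec_prod_zero[OF A] u by blast
  have head: "v $ e (Suc j) = 0" if "j < l" for j
  proof -
    have "v $ e (Suc j) = Matrix.vec_index u j"
      using that by (simp add: u_def)
    then show ?thesis
      using \<open>u = 0\<^sub>v l\<close> that by simp
  qed
  have "v $ e m = 0" if m: "m \<in> {1..CARD('d)}" for m
  proof (cases "m \<le> l")
    case True
    then obtain j where "m = Suc j" "j < l"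
      using m by (cases m) auto
    then show ?thesis
      using head by simp
  next
    case False
    then show ?thesis
      using tail[of m] m by simp
  qed
  then have "v $ a = 0" for a
    using bij_betw_imp_surj_on[OF e] by (metis imageE UNIV_I)
  then show ?thesis
    by (simp add: vec_eq_iff)
qed

text \<open>The conditions are as many linear equations as unknowns, so the trivial kernel makes the
  system bijective. Right-hand sides 0 and a row of the identity give the tangent fields.\<close>

lemma jacobian_system_ex1:
  fixes e :: "nat \<Rightarrow> 'd::finite"
  assumes e: "bij_betw e {1..CARD('d)} UNIV"
    and l: "l \<le> CARD('d)"
    and det: "jacobian_det e l f x \<noteq> 0"
  shows "\<exists>!v. (\<forall>k\<in>{1..l}. v \<bullet> gradient (f k) x = a k) \<and>
              (\<forall>r\<in>{1..CARD('d) - l}. v $ e (l + r) = b r)"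
proof -
  define m where "m = inv_into {1..CARD('d)} e"
  have m: "m (e i) = i" if "i \<in> {1..CARD('d)}" for i
    using e that by (simp add: m_def bij_betw_inv_into_left)
  \<comment> \<open>\<open>L\<close> collects all left-hand sides in one endomorphism of
    \<open>real ^ 'd\<close>: the inner products in the first \<open>l\<close> slots, the
    coordinates themselves in the others. Here \<open>m\<close> recovers the number of a coordinate
    from its index.\<close>
  define L where "L v = (\<chi> i. if m i \<le> l then v \<bullet> gradient (f (m i)) x else v $ i)" for v
  have L_head: "L v $ e k = v \<bullet> gradient (f k) x" if "k \<in> {1..l}" for v k
    using that l by (simp add: L_def m)
  have L_tail: "L v $ e (l + r) = v $ e (l + r)" if "r \<in> {1..CARD('d) - l}" for v r
  proof -
    have "l + r \<in> {1..CARD('d)}"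
      using that l by auto
    from m[OF this] show ?thesis
      using that by (simp add: L_def)
  qed
  have lin: "linear L"
    by (rule linearI) (auto simp: L_def vec_eq_iff inner_add_left)
  have inj: "inj L"
    unfolding linear_injective_0[OF lin]
  proof (intro allI impI)
    fix v assume "L v = 0"
    then show "v = 0"
      using L_head[of _ v] L_tail[of _ v]
      by (intro jacobian_system_trivial_kernel[OF e l det]) auto
  qed
  \<comment> \<open>In finite dimension the injective \<open>L\<close> is onto, so the right-hand
    side, with \<open>b\<close> shifted by \<open>l\<close> slots, has a preimage.\<close>
  obtain v where v: "L v = (\<chi> i. if m i \<le> l then a (m i) else b (m i - l))"
    using linear_injective_imp_surjective[OF lin inj] by (metis surjD)
  show ?thesis
  proof (rule ex1I[of _ v], intro conjI ballI)
    show "v \<bullet> gradient (f k) x = a k" if "k \<in> {1..l}" for k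
      using that l by (simp add: m v flip: L_head)
    show "v $ e (l + r) = b r" if "r \<in> {1..CARD('d) - l}" for r
    proof -
      have "l + r \<in> {1..CARD('d)}"
        using that l by auto
      from m[OF this] show ?thesis
        using that by (simp add: v flip: L_tail)
    qed
  next
    fix w
    assume w: "(\<forall>k\<in>{1..l}. w \<bullet> gradient (f k) x = a k) \<and>
               (\<forall>r\<in>{1..CARD('d) - l}. w $ e (l + r) = b r)"
    have "L w $ e i = L v $ e i" if i: "i \<in> {1..CARD('d)}" for i
    proof (cases "i \<le> l")
      case True
      then show ?thesis using w i by (simp add: L_head v m)
    next
      case False
      then obtain r where "i = l + r" "r \<in> {1..CARD('d) - l}"
        using i by (intro that[of "i - l"]) auto
      then show ?thesis
        using w L_tail[of r w] False i by (simp add: v m)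
    qed
    then have "L w = L v"
      using bij_betw_imp_surj_on[OF e] unfolding vec_eq_iff by (metis imageE UNIV_I)
    then show "w = v"
      using inj by (simp add: inj_eq)
  qed
qed

section \<open>Tangent fields and functions along the iterated flow\<close>

lemma tangent_vec:
  fixes e :: "nat \<Rightarrow> 'd::finite"
  assumes "bij_betw e {1..CARD('d)} UNIV" "l \<le> CARD('d)" "jacobian_det e l f x \<noteq> 0"
  shows "k \<in> {1..l} \<Longrightarrow> tangent_vec e l f s x \<bullet> gradient (f k) x = 0"
    and "r \<in> {1..CARD('d) - l} \<Longrightarrow> tangent_vec e l f s x $ e (l + r) = (if r = s then 1 else 0)"
  using theI'[OF jacobian_system_ex1[OF assms, of "\<lambda>_. 0" "\<lambda>r. if r = s then 1 else 0"]]
  unfolding tangent_vec_def by auto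

text \<open>By the chain rule \<open>G\<close> grows at the constant rate \<open>c j\<close> in the
  last variable, and at time 0 the solution is the previous one, so the increments add up by
  induction on \<open>j\<close>. It is applied to the functions \<open>F k lam\<close>, with rate 0,
  and to the last coordinates, with rates 0 or 1.\<close>

lemma iterated_solution_linear_growth:
  fixes e :: "nat \<Rightarrow> 'd::finite" and G :: "real ^ 'd \<Rightarrow> real"
  assumes sol: "iterated_solution e l f x0 V I y"
    and I: "\<And>j. j \<in> {1..CARD('d) - l} \<Longrightarrow> is_interval (I j) \<and> 0 \<in> I j"
    and G: "\<And>x. x \<in> V \<Longrightarrow> (G has_derivative G' x) (at x)"
    and c: "\<And>j x. j \<in> {1..CARD('d) - l} \<Longrightarrow> x \<in> V \<Longrightarrow> G' x (tangent_vec e l f j x) = c j"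
    and "j \<in> {1..CARD('d) - l}" "t \<in> (\<Pi>\<^sub>E i\<in>{1..j}. I i)"
  shows "G (y j t) = G x0 + (\<Sum>i\<in>{1..j}. c i * t i)"
  using assms(5,6)
proof (induction j arbitrary: t)
  \<comment> \<open>Index 0 is outside the range, so this case is vacuous. The first equation is
    covered by the successor step, where \<open>j = 0\<close> gives the start value
    \<open>x0\<close> and an empty sum.\<close>
  case 0
  then show ?case by simp
next
  case (Suc j)
  \<comment> \<open>The tuple \<open>t\<close> is split into its first \<open>j\<close> entries and
    the last one; \<open>restrict\<close> keeps the shorter tuple extensional.\<close>
  define s where "s = restrict t {1..j}"
  have s: "s \<in> (\<Pi>\<^sub>E i\<in>{1..j}. I i)"
    using Suc.prems by (auto simp: s_def PiE_iff)
  have s_upd: "s(Suc j := \<tau>) \<in> (\<Pi>\<^sub>E i\<in>{1..Suc j}. I i)" if "\<tau> \<in> I (Suc j)" for \<tau>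
    using s that by (auto simp: PiE_iff extensional_def le_Suc_eq)
  have t: "s(Suc j := t (Suc j)) = t"
    using Suc.prems by (auto simp: s_def fun_eq_iff PiE_iff extensional_def le_Suc_eq)
  have t_Suc: "t (Suc j) \<in> I (Suc j)"
    using Suc.prems by (auto simp: PiE_iff)
  have V: "y (Suc j) u \<in> V" if "u \<in> (\<Pi>\<^sub>E i\<in>{1..Suc j}. I i)" for u
    using sol Suc.prems(1) that by (auto simp: iterated_solution_def)
  have init: "y (Suc j) (s(Suc j := 0)) = (if j = 0 then x0 else y j s)"
    and ode: "\<And>\<tau>. \<tau> \<in> I (Suc j) \<Longrightarrow>
      ((\<lambda>\<tau>. y (Suc j) (s(Suc j := \<tau>))) has_vector_derivative
        tangent_vec e l f (Suc j) (y (Suc j) (s(Suc j := \<tau>)))) (at \<tau> within I (Suc j))"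
    using sol Suc.prems(1) s unfolding iterated_solution_def by fastforce+
  \<comment> \<open>Subtracting the expected growth leaves a function with zero derivative within
    the interval, hence constant there; it is then compared at \<open>t (Suc j)\<close> and at
    0.\<close>
  define h where "h \<tau> = G (y (Suc j) (s(Suc j := \<tau>))) - c (Suc j) * \<tau>" for \<tau>
  have "(h has_vector_derivative 0) (at \<tau> within I (Suc j))" if \<tau>: "\<tau> \<in> I (Suc j)" for \<tau>
  proof -
    have x: "y (Suc j) (s(Suc j := \<tau>)) \<in> V"
      using V s_upd \<tau> by blast
    have "((\<lambda>\<tau>. G (y (Suc j) (s(Suc j := \<tau>)))) has_vector_derivative c (Suc j))
            (at \<tau> within I (Suc j))"
      using vector_derivative_diff_chain_within[OF ode[OF \<tau>] has_derivative_at_withinI[OF G[OF x]]]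
      by (simp add: o_def c[OF Suc.prems(1) x] del: fun_upd_apply)
    then show ?thesis
      unfolding h_def by (auto intro!: derivative_eq_intros)
  qed
  then obtain C where "h \<tau> = C" if "\<tau> \<in> I (Suc j)" for \<tau>
    using has_vector_derivative_zero_constant[of "I (Suc j)" h] I[OF Suc.prems(1)]
    by (auto simp: is_interval_convex_1)
  then have "h (t (Suc j)) = h 0"
    using t_Suc I[OF Suc.prems(1)] by simp
  then have "G (y (Suc j) t) = G (if j = 0 then x0 else y j s) + c (Suc j) * t (Suc j)"
    by (simp add: h_def t init)
  also have "G (if j = 0 then x0 else y j s) = G x0 + (\<Sum>i\<in>{1..j}. c i * s i)"
    using Suc.IH[of s] s Suc.prems(1) by auto
  also have "(\<Sum>i\<in>{1..j}. c i * s i) = (\<Sum>i\<in>{1..j}. c i * t i)"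
    by (simp add: s_def)
  finally show ?case by simp
qed

section \<open>Differentiation of the iterated solution in the parameter\<close>

theorem proposition1:
  fixes e :: "nat \<Rightarrow> 'd::finite"
    and l :: nat
    and \<Omega> V1 :: "(real ^ 'd) set"
    and x0 :: "real ^ 'd"
    and F :: "nat \<Rightarrow> real \<Rightarrow> real ^ 'd \<Rightarrow> real"
    and lam0 :: real
    and I :: "nat \<Rightarrow> real set"
    and y z :: "nat \<Rightarrow> real \<Rightarrow> (nat \<Rightarrow> real) \<Rightarrow> real ^ 'd"
  assumes e: "bij_betw e {1..CARD('d)} UNIV"
    and l: "1 \<le> l" "l \<le> CARD('d) - 1"
    and \<Omega>: "open \<Omega>" "connected \<Omega>" "bounded \<Omega>" "x0 \<in> \<Omega>"
    and F_C2: "\<And>k. k \<in> {1..l} \<Longrightarrow> C2_on (\<lambda>(x, lam). F k lam x) (\<Omega> \<times> {-1<..<1})"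
    and F_x0: "\<And>k lam. k \<in> {1..l} \<Longrightarrow> lam \<in> {-1<..<1} \<Longrightarrow> F k lam x0 = 0"
    and det_x0: "jacobian_det e l (\<lambda>k. F k 0) x0 \<noteq> 0"
    and lam0: "0 < lam0" "lam0 \<le> 1"
    and V1: "x0 \<in> interior V1" "V1 \<subseteq> \<Omega>"
    and det_V1: "\<And>lam x. lam \<in> {-lam0<..<lam0} \<Longrightarrow> x \<in> V1 \<Longrightarrow>
                   jacobian_det e l (\<lambda>k. F k lam) x \<noteq> 0"
    and I: "\<And>j. j \<in> {1..CARD('d) - l} \<Longrightarrow> is_interval (I j) \<and> closed (I j) \<and> 0 \<in> interior (I j)"
    and y: "\<And>lam. lam \<in> {-lam0<..<lam0} \<Longrightarrow>
              iterated_solution e l (\<lambda>k. F k lam) x0 V1 I (\<lambda>j. y j lam)"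
    and z: "\<And>j lam t. j \<in> {1..CARD('d) - l} \<Longrightarrow> lam \<in> {-lam0<..<lam0} \<Longrightarrow>
              t \<in> (\<Pi>\<^sub>E i\<in>{1..j}. I i) \<Longrightarrow>
              ((\<lambda>\<mu>. y j \<mu> t) has_vector_derivative z j lam t) (at lam)"
  shows "(\<forall>lam\<in>{-lam0<..<lam0}. \<forall>j\<in>{1..CARD('d) - l}. \<forall>t \<in> (\<Pi>\<^sub>E i\<in>{1..j}. I i).
           \<forall>r\<in>{1..CARD('d) - l}. z j lam t $ e (l + r) = 0) \<and>
         (\<forall>lam\<in>{-lam0<..<lam0}. \<forall>j\<in>{1..CARD('d) - l}. \<forall>t \<in> (\<Pi>\<^sub>E i\<in>{1..CARD('d) - l}. I i).
           {w. (\<forall>r\<in>{1..CARD('d) - l}. w $ e (l + r) = 0) \<and>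
               (\<forall>k\<in>{1..l}. gradient (F k lam) (y j lam (restrict t {1..j})) \<bullet> w
                            + deriv (\<lambda>\<mu>. F k \<mu> (y j lam (restrict t {1..j}))) lam = 0)}
           = {z j lam (restrict t {1..j})})"
proof -
  define J where "J = {-lam0<..<lam0}"
  have J: "lam \<in> {-1<..<1}" if "lam \<in> J" for lam
    using that lam0 by (auto simp: J_def)
  have l': "l \<le> CARD('d)"
    using l by simp
  have I': "is_interval (I j) \<and> 0 \<in> I j" if "j \<in> {1..CARD('d) - l}" for j
    using I[OF that] interior_subset by blast
  \<comment> \<open>The joint derivative in \<open>(x, lam)\<close> is used because both arguments
    move with the parameter in \<open>F k \<mu> (y j \<mu> t)\<close>. Its restrictions to
    \<open>(h, 0)\<close> and along \<open>(0, 1)\<close> are the two terms of the system for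
    \<open>z\<close>.\<close>
  define D where "D k x lam = frechet_derivative (\<lambda>(x, lam). F k lam x) (at (x, lam))" for k x lam
  have D: "((\<lambda>(x, lam). F k lam x) has_derivative D k x lam) (at (x, lam))"
    if "k \<in> {1..l}" "x \<in> V1" "lam \<in> J" for k x lam
  proof -
    have "(\<lambda>(x, lam). F k lam x) differentiable at (x, lam)"
      using F_C2[OF that(1)] V1(2) that J[OF that(3)] unfolding C2_on_def differentiable_def by blast
    then show ?thesis
      unfolding D_def frechet_derivative_works .
  qed
  have F_x: "(F k lam has_derivative (\<lambda>h. D k x lam (h, 0))) (at x)"
    if "k \<in> {1..l}" "x \<in> V1" "lam \<in> J" for k x lam
  proof -
    have "((\<lambda>x. (x, lam)) has_derivative (\<lambda>h. (h, 0))) (at x)"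
      by (auto intro!: derivative_eq_intros)
    from has_derivative_compose[OF this D[OF that]] show ?thesis by simp
  qed
  have F_lam: "deriv (\<lambda>\<mu>. F k \<mu> x) lam = D k x lam (0, 1)"
    if "k \<in> {1..l}" "x \<in> V1" "lam \<in> J" for k x lam
  proof -
    have "(Pair x has_vector_derivative (0, 1)) (at lam)"
      by (auto intro!: derivative_eq_intros simp: has_vector_derivative_def)
    from vector_derivative_diff_chain_within[OF this has_derivative_at_withinI[OF D[OF that]]]
    have "((\<lambda>\<mu>. F k \<mu> x) has_vector_derivative D k x lam (0, 1)) (at lam)"
      by (simp add: o_def)
    then show ?thesis
      by (intro DERIV_imp_deriv) (simp add: has_real_derivative_iff_has_vector_derivative)
  qed
  have y_V1: "y j lam t \<in> V1"
    if "lam \<in> J" "j \<in> {1..CARD('d) - l}" "t \<in> (\<Pi>\<^sub>E i\<in>{1..j}. I i)" for lam j t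
    using y[of lam] that unfolding J_def iterated_solution_def by blast
  \<comment> \<open>The fields are orthogonal to the gradient of \<open>F k lam\<close>, so the
    growth rate is 0 and the value at \<open>x0\<close>, which is 0 for every \<open>lam\<close>,
    persists.\<close>
  have F_zero: "F k lam (y j lam t) = 0"
    if "k \<in> {1..l}" "lam \<in> J" "j \<in> {1..CARD('d) - l}" "t \<in> (\<Pi>\<^sub>E i\<in>{1..j}. I i)" for k lam j t
  proof -
    have "D k x lam (tangent_vec e l (\<lambda>k. F k lam) i x, 0) = 0" if x: "x \<in> V1" for i x
      using tangent_vec(1)[OF e l' det_V1[of lam x], of k i] \<open>lam \<in> J\<close> \<open>k \<in> {1..l}\<close> x
        gradient_inner[OF F_x[OF \<open>k \<in> {1..l}\<close> x \<open>lam \<in> J\<close>]]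
      by (simp add: J_def inner_commute)
    from iterated_solution_linear_growth[OF y I' F_x[OF that(1) _ that(2)] this that(3,4)]
    show ?thesis
      using that F_x0 J by (simp add: J_def)
  qed
  \<comment> \<open>The decisive point is that the right-hand side is free of \<open>lam\<close>:
    the last coordinates of the fields are fixed rows of the identity.\<close>
  have y_tail: "y j lam t $ e (l + r) = x0 $ e (l + r) + (\<Sum>i\<in>{1..j}. (if r = i then 1 else 0) * t i)"
    if "lam \<in> J" "j \<in> {1..CARD('d) - l}" "t \<in> (\<Pi>\<^sub>E i\<in>{1..j}. I i)" "r \<in> {1..CARD('d) - l}"
    for lam j t r
  proof -
    have G: "((\<lambda>x. x $ e (l + r)) has_derivative (\<lambda>v. v $ e (l + r))) (at x)" for x :: "real ^ 'd"
      by (intro bounded_linear_imp_has_derivative bounded_linear_vec_nth)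
    have c: "tangent_vec e l (\<lambda>k. F k lam) i x $ e (l + r) = (if r = i then 1 else 0)"
      if "x \<in> V1" for i x
      using tangent_vec(2)[OF e l' det_V1] that \<open>lam \<in> J\<close> \<open>r \<in> _\<close> by (simp add: J_def)
    from iterated_solution_linear_growth[OF y I' G c that(2,3)] that(1) show ?thesis
      by (simp add: J_def)
  qed
  have z_tail: "z j lam t $ e (l + r) = 0"
    if "lam \<in> J" "j \<in> {1..CARD('d) - l}" "t \<in> (\<Pi>\<^sub>E i\<in>{1..j}. I i)" "r \<in> {1..CARD('d) - l}"
    for lam j t r
  proof -
    have "((\<lambda>\<mu>. y j \<mu> t $ e (l + r)) has_vector_derivative z j lam t $ e (l + r)) (at lam)"
      using bounded_linear.has_vector_derivative[OF bounded_linear_vec_nth z] that by (simp add: J_def)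
    \<comment> \<open>The coordinate is constant in the parameter on the open interval
      \<open>J\<close>, so its derivative vanishes; uniqueness of derivatives gives part a).\<close>
    moreover have "((\<lambda>\<mu>. y j \<mu> t $ e (l + r)) has_vector_derivative 0) (at lam)"
      by (rule has_vector_derivative_transform_within_open[where S = J, OF has_vector_derivative_const])
        (use that y_tail in \<open>auto simp: J_def\<close>)
    ultimately show ?thesis
      by (rule vector_derivative_unique_at)
  qed
  have z_eq: "gradient (F k lam) (y j lam t) \<bullet> z j lam t + deriv (\<lambda>\<mu>. F k \<mu> (y j lam t)) lam = 0"
    if "k \<in> {1..l}" "lam \<in> J" "j \<in> {1..CARD('d) - l}" "t \<in> (\<Pi>\<^sub>E i\<in>{1..j}. I i)" for k lam j t
  proof -
    note Dk = D[OF that(1) y_V1[OF that(2-4)] that(2)]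
    \<comment> \<open>The identity \<open>F k \<mu> (y j \<mu> t) = 0\<close>, valid for all
      \<open>\<mu>\<close> in \<open>J\<close>, is differentiated along this curve, whose velocity
      is \<open>(z j lam t, 1)\<close>.\<close>
    have "((\<lambda>\<mu>. (y j \<mu> t, \<mu>)) has_vector_derivative (z j lam t, 1)) (at lam)"
      using z that by (intro has_vector_derivative_Pair) (auto simp: J_def intro!: derivative_eq_intros)
    from vector_derivative_diff_chain_within[OF this has_derivative_at_withinI[OF Dk]]
    have "((\<lambda>\<mu>. F k \<mu> (y j \<mu> t)) has_vector_derivative D k (y j lam t) lam (z j lam t, 1)) (at lam)"
      by (simp add: o_def)
    moreover have "((\<lambda>\<mu>. F k \<mu> (y j \<mu> t)) has_vector_derivative 0) (at lam)"
      by (rule has_vector_derivative_transform_within_open[where S = J, OF has_vector_derivative_const])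
        (use that F_zero in \<open>auto simp: J_def\<close>)
    ultimately have "D k (y j lam t) lam (z j lam t, 1) = 0"
      by (rule vector_derivative_unique_at)
    moreover have "D k (y j lam t) lam (z j lam t, 1)
        = D k (y j lam t) lam (z j lam t, 0) + D k (y j lam t) lam (0, 1)"
      using linear_add[OF has_derivative_linear[OF Dk], of "(z j lam t, 0)" "(0, 1)"] by simp
    ultimately show ?thesis
      using gradient_inner[OF F_x[OF that(1) y_V1[OF that(2-4)] that(2)]]
        F_lam[OF that(1) y_V1[OF that(2-4)] that(2)] by simp
  qed
  \<comment> \<open>The inhomogeneous terms cancel in the difference of two solutions, which
    therefore lies in the trivial kernel.\<close>
  have unique: "w = z j lam t"
    if jt: "lam \<in> J" "j \<in> {1..CARD('d) - l}" "t \<in> (\<Pi>\<^sub>E i\<in>{1..j}. I i)"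
      and null: "\<forall>r\<in>{1..CARD('d) - l}. w $ e (l + r) = 0"
      and sys: "\<forall>k\<in>{1..l}. gradient (F k lam) (y j lam t) \<bullet> w + deriv (\<lambda>\<mu>. F k \<mu> (y j lam t)) lam = 0"
    for lam j t w
  proof -
    have "w - z j lam t = 0"
    proof (rule jacobian_system_trivial_kernel[OF e l'])
      show "jacobian_det e l (\<lambda>k. F k lam) (y j lam t) \<noteq> 0"
        using det_V1 y_V1[OF jt] jt(1) by (simp add: J_def)
      show "(w - z j lam t) \<bullet> gradient (F k lam) (y j lam t) = 0" if k: "k \<in> {1..l}" for k
        using z_eq[OF k jt] bspec[OF sys k]
        by (simp add: inner_diff_left inner_commute[of w] inner_commute[of "z j lam t"])
      show "(w - z j lam t) $ e (l + r) = 0" if "r \<in> {1..CARD('d) - l}" for r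
        using null z_tail[OF jt that] that by simp
    qed
    then show ?thesis by simp
  qed
  \<comment> \<open>In part b) \<open>t\<close> is a full tuple, and \<open>y j\<close> and
    \<open>z j\<close> take its first \<open>j\<close> entries.\<close>
  have restr: "restrict t {1..j} \<in> (\<Pi>\<^sub>E i\<in>{1..j}. I i)"
    if "t \<in> (\<Pi>\<^sub>E i\<in>{1..CARD('d) - l}. I i)" "j \<in> {1..CARD('d) - l}" for t j
    using that by (auto simp: PiE_iff)
  show ?thesis
    unfolding J_def[symmetric]
  proof (intro conjI ballI)
    fix lam j t assume "lam \<in> J" "j \<in> {1..CARD('d) - l}" "t \<in> (\<Pi>\<^sub>E i\<in>{1..CARD('d) - l}. I i)"
    note * = this(1,2) restr[OF this(3,2)]
    show "{w. (\<forall>r\<in>{1..CARD('d) - l}. w $ e (l + r) = 0) \<and>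
              (\<forall>k\<in>{1..l}. gradient (F k lam) (y j lam (restrict t {1..j})) \<bullet> w
                + deriv (\<lambda>\<mu>. F k \<mu> (y j lam (restrict t {1..j}))) lam = 0)}
          = {z j lam (restrict t {1..j})}"
      (is "?S = _")
    proof (rule equalityI; rule subsetI)
      fix w assume "w \<in> ?S"
      then show "w \<in> {z j lam (restrict t {1..j})}"
        using unique[OF *] by blast
    next
      fix w assume "w \<in> {z j lam (restrict t {1..j})}"
      then show "w \<in> ?S"
        using z_tail[OF *] z_eq[OF _ *] by blast
    qed
  qed (rule z_tail)
qed

end
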